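(* Let $S$ be a finite set of positive integers. Then: (1) the generating function $\mathcal M_S(q) := \sum_{n\ge0} M_S(n) q^n$ can be written as $\mathcal M_S(q) = \dfrac{f_S(q)}{\prod_{j\in S}(1-q^j)}$ where $f_S(q)$ is a polynomial with integer coefficients; (2) there exists $n_0$ such that for $n\ge n_0$, $M_S(n)$ is given by a quasipolynomial, i.e. $M_S(n) = \sum_{i=0}^{m} c_i(n)\, n^i$ with each $c_i$ a periodic function of $n$; moreover, the $c_i$ may be taken to be sums of periodic functions whose periods are divisors of elements of $S$.
   Context: $M_S(n)$ is the number of distinct values of the multinomial coefficients $n!/(\lambda_1!\cdots\lambda_r!)$ as $(\lambda_1,\dots,\lambda_r)$ ranges over all partitions of $n$ whose parts all lie in $S$. *)

theory Defs
  imports Complex_Main "HOL-Library.Multiset" "HOL-Computational_Algebra.Computational_Algebra"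
begin

definition partitions_in :: "nat set \<Rightarrow> nat \<Rightarrow> nat multiset set" where
  "partitions_in S n = {P. 0 \<notin># P \<and> set_mset P \<subseteq> S \<and> sum_mset P = n}"

text \<open>Real division is used so that no truncation is involved.\<close>

definition multinomial_coeff :: "nat multiset \<Rightarrow> real" where
  "multinomial_coeff P = fact (sum_mset P) / (\<Prod>k\<in>#P. fact k)"

definition M :: "nat set \<Rightarrow> nat \<Rightarrow> nat" where
  "M S n = card (multinomial_coeff ` partitions_in S n)"

definition has_period :: "nat \<Rightarrow> (nat \<Rightarrow> real) \<Rightarrow> bool" where
  "has_period p f \<longleftrightarrow> p > 0 \<and> (\<forall>n. f (n + p) = f n)"

definition periodic :: "(nat \<Rightarrow> real) \<Rightarrow> bool" where
  "periodic f \<longleftrightarrow> (\<exists>p. has_period p f)"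

text \<open>Finite sums of periodic functions, each having a period that divides some element of
  \<open>S\<close>. The empty sum is allowed, which is what the case \<open>S = {}\<close> needs.\<close>

definition sum_of_periodic_dividing :: "nat set \<Rightarrow> (nat \<Rightarrow> real) \<Rightarrow> bool" where
  "sum_of_periodic_dividing S f \<longleftrightarrow>
     (\<exists>(k::nat) g. (\<forall>l<k. \<exists>d. (\<exists>s\<in>S. d dvd s) \<and> has_period d (g l)) \<and>
                   (\<forall>n. f n = (\<Sum>l<k. g l n)))"

end

theory Submission
  imports Defs "HOL-Library.Multiset_Order" "HOL-Computational_Algebra.Field_as_Ring"
begin

text \<open>
  For fixed \<open>n\<close>, two partitions have the same multinomial coefficient iff their products of
  factorials agree, and this relation is compatible with adding parts. Hence the partitions that are
  minimal in their class with respect to a total order compatible with addition form a set closed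
  under sub-multisets, i.e. the complement of a monomial ideal, and \<open>M S n\<close> counts its members of
  weight \<open>n\<close>. The weight series \<open>H\<close> of such a set \<open>D\<close> satisfies
  \<open>H(D) = H({P \<in> D. j \<notin> P}) + X\<^sup>j H(D : j)\<close>, and by Dickson's lemma iterating the colon operation
  \<open>D : j\<close> stabilises; at a fixed point \<open>H(D) (1 - X\<^sup>j) = H({P \<in> D. j \<notin> P})\<close>. Induction on \<open>S\<close> then
  clears all denominators. The quasipolynomial comes from a partial fraction decomposition into
  terms \<open>N\<^sub>s / (1 - X\<^sup>s)\<^sup>K\<close> with \<open>s \<in> S\<close>.
\<close>

section \<open>Weight series of down-closed sets of multisets\<close>

text \<open>Monotone subsequences are extracted one coordinate at a time; passing to a further
  subsequence keeps the earlier coordinates nondecreasing.\<close>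

lemma dickson_subseq:
  fixes f :: "nat \<Rightarrow> 'a multiset"
  assumes "finite S"
  shows "\<exists>r :: nat \<Rightarrow> nat. strict_mono r \<and> (\<forall>j\<in>S. incseq (\<lambda>n. count (f (r n)) j))"
  using assms
proof (induction S rule: finite_induct)
  case empty
  show ?case by (rule exI[of _ id]) (auto simp: strict_mono_def)
next
  case (insert x S)
  then obtain r :: "nat \<Rightarrow> nat" where r: "strict_mono r" "\<forall>j\<in>S. incseq (\<lambda>n. count (f (r n)) j)"
    by auto
  obtain q :: "nat \<Rightarrow> nat" where q: "strict_mono q" "monoseq (\<lambda>n. count (f (r (q n))) x)"
    using seq_monosub[of "\<lambda>n. count (f (r n)) x"] by (auto simp: o_def)
  \<comment> \<open>The subsequence may decrease in coordinate \<open>x\<close>; but a decreasing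
    sequence of naturals is constant once it attains its minimum, so cutting off a prefix
    suffices.\<close>
  have "\<exists>N. \<forall>m\<ge>N. \<forall>n\<ge>m. count (f (r (q m))) x \<le> count (f (r (q n))) x"
  proof (cases "incseq (\<lambda>n. count (f (r (q n))) x)")
    case True
    then show ?thesis by (auto simp: incseq_def)
  next
    case False
    with q have dec: "decseq (\<lambda>n. count (f (r (q n))) x)"
      by (simp add: monoseq_iff)
    define v where "v = (LEAST v. v \<in> range (\<lambda>n. count (f (r (q n))) x))"
    have "v \<in> range (\<lambda>n. count (f (r (q n))) x)"
      unfolding v_def by (rule LeastI_ex) blast
    then obtain N where N: "v = count (f (r (q N))) x" by blast
    have "v \<le> count (f (r (q n))) x" for n
      unfolding v_def by (rule Least_le) blast
    then have "count (f (r (q m))) x \<le> count (f (r (q n))) x" if "N \<le> m" for m n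
      using decseqD[OF dec that] unfolding N by (meson order.trans)
    then show ?thesis by blast
  qed
  then obtain N where N: "\<And>m n. N \<le> m \<Longrightarrow> m \<le> n \<Longrightarrow> count (f (r (q m))) x \<le> count (f (r (q n))) x"
    by blast
  have "strict_mono (\<lambda>n. r (q (n + N)))"
    using r(1) q(1) by (auto simp: strict_mono_def)
  moreover have "incseq (\<lambda>n. count (f (r (q (n + N)))) j)" if "j \<in> insert x S" for j
    using that r(2) q(1) N by (auto simp: incseq_def strict_mono_less_eq)
  ultimately show ?case by blast
qed

lemma dickson:
  fixes f :: "nat \<Rightarrow> 'a multiset"
  assumes "finite S" "\<And>k. set_mset (f k) \<subseteq> S"
  shows "\<exists>i j. i < j \<and> f i \<subseteq># f j"
proof -
  obtain r :: "nat \<Rightarrow> nat" where r: "strict_mono r" "\<forall>j\<in>S. incseq (\<lambda>n. count (f (r n)) j)"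
    using dickson_subseq[OF assms(1)] by blast
  have "count (f (r 0)) a \<le> count (f (r 1)) a" for a
  proof (cases "a \<in> S")
    case True
    with r(2) show ?thesis by (auto simp: incseq_def)
  next
    case False
    with assms(2)[of "r 0"] show ?thesis by (metis count_inI subsetD zero_le)
  qed
  then have "f (r 0) \<subseteq># f (r 1)" by (rule mset_subset_eqI)
  moreover have "r 0 < r 1" using r(1) by (simp add: strict_mono_def)
  ultimately show ?thesis by blast
qed

section \<open>Down-closed sets and iterated colons\<close>

definition down_closed :: "'a multiset set \<Rightarrow> bool" where
  "down_closed D \<longleftrightarrow> (\<forall>P\<in>D. \<forall>Q. Q \<subseteq># P \<longrightarrow> Q \<in> D)"

definition weight_series :: "nat multiset set \<Rightarrow> int fps" where
  "weight_series D = Abs_fps (\<lambda>n. int (card {P \<in> D. sum_mset P = n}))"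

text \<open>If \<open>D\<close> is the complement of a monomial ideal I, this is the complement of
  the ideal quotient I : x_j.\<close>

definition colon :: "'a multiset set \<Rightarrow> 'a \<Rightarrow> 'a multiset set" where
  "colon D j = {P. add_mset j P \<in> D}"

lemma down_closed_colon: "down_closed D \<Longrightarrow> down_closed (colon D j)"
  unfolding down_closed_def colon_def by (metis mem_Collect_eq mset_subset_eq_add_mset_cancel)

lemma colon_subset: "down_closed D \<Longrightarrow> colon D j \<subseteq> D"
  unfolding down_closed_def colon_def
  by (metis (no_types, lifting) diff_add_mset_swap diff_subset_eq_self mem_Collect_eq subsetI add_mset_remove_trivial)

text \<open>Noetherian argument: were every step strict, each would lose some \<open>P k\<close>;
  Dickson's lemma puts some \<open>P i\<close> below a later \<open>P k\<close>, and down-closedness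
  then keeps \<open>P i\<close> in the very set it was chosen to miss.\<close>

lemma colon_chain_stabilises:
  assumes "finite S" "D \<subseteq> {P. set_mset P \<subseteq> S}" "down_closed D"
  shows "\<exists>k. colon (((\<lambda>E. colon E j) ^^ k) D) j = ((\<lambda>E. colon E j) ^^ k) D"
proof (rule ccontr)
  define E where "E k = ((\<lambda>E. colon E j) ^^ k) D" for k
  assume "\<not> ?thesis"
  then have neq: "E (Suc k) \<noteq> E k" for k by (simp add: E_def)
  have down: "down_closed (E k)" for k
    by (induction k) (simp_all add: E_def assms down_closed_colon)
  have "E (Suc k) \<subseteq> E k" for k
    using colon_subset[OF down[of k]] by (simp add: E_def)
  then have anti: "i \<le> k \<Longrightarrow> E k \<subseteq> E i" for i k
    by (rule lift_Suc_antimono_le)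
  have "\<exists>P. P \<in> E k \<and> P \<notin> E (Suc k)" for k
    using neq[of k] anti[of k "Suc k"] by auto
  then obtain P where P: "\<And>k. P k \<in> E k" "\<And>k. P k \<notin> E (Suc k)" by metis
  have "set_mset (P k) \<subseteq> S" for k
    using P(1)[of k] anti[of 0 k] assms(2) by (auto simp: E_def)
  then obtain i k where ik: "i < k" "P i \<subseteq># P k"
    using dickson[OF assms(1), of P] by blast
  have "P k \<in> E (Suc i)" using P(1)[of k] anti[of "Suc i" k] ik by auto
  with ik down have "P i \<in> E (Suc i)" unfolding down_closed_def by blast
  with P(2) show False by blast
qed

section \<open>Rationality of weight series\<close>

text \<open>Positive parts bound the size of a multiset by its weight. Finiteness matters because
  \<open>card\<close> is 0 on infinite sets.\<close>

lemma finite_multisets_of_weight: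
  assumes "finite S" "\<forall>j\<in>S. (j::nat) > 0"
  shows "finite {P. set_mset P \<subseteq> S \<and> sum_mset P = n}"
proof (rule finite_subset)
  show "finite (\<Union>k\<le>n. multisets_of_size S k)"
    using assms(1) by auto
  have "size P \<le> sum_mset P" if "set_mset P \<subseteq> S" for P
    using that
  proof (induction P)
    case (add x P)
    then have "x > 0" using assms(2) by auto
    with add show ?case by auto
  qed simp
  then show "{P. set_mset P \<subseteq> S \<and> sum_mset P = n} \<subseteq> (\<Union>k\<le>n. multisets_of_size S k)"
    by (auto simp: multisets_of_size_def)
qed

text \<open>Removing one copy of \<open>j\<close> maps the members containing \<open>j\<close>
  bijectively onto \<open>colon D j\<close> and lowers the weight by \<open>j\<close>.\<close>

lemma weight_series_split:
  assumes S: "finite S" "\<forall>i\<in>S. (i::nat) > 0" and D: "D \<subseteq> {P. set_mset P \<subseteq> S}"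
  shows "weight_series D = weight_series {P \<in> D. j \<notin># P} + fps_X ^ j * weight_series (colon D j)"
proof (rule fps_ext)
  fix n
  have fin: "finite {P \<in> D. sum_mset P = n}"
    using D by (intro finite_subset[OF _ finite_multisets_of_weight[OF S, of n]]) auto
  have split: "{P \<in> D. sum_mset P = n} =
      {P \<in> {P \<in> D. j \<notin># P}. sum_mset P = n} \<union> {P \<in> D. j \<in># P \<and> sum_mset P = n}"
    by auto
  have "card {P \<in> D. sum_mset P = n} = card {P \<in> {P \<in> D. j \<notin># P}. sum_mset P = n}
      + card {P \<in> D. j \<in># P \<and> sum_mset P = n}"
    by (subst split, rule card_Un_disjoint) (auto intro: finite_subset[OF _ fin])
  moreover have "card {P \<in> D. j \<in># P \<and> sum_mset P = n} =
      (if n < j then 0 else card {P \<in> colon D j. sum_mset P = n - j})"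
  proof (cases "n < j")
    case True
    then have "{P \<in> D. j \<in># P \<and> sum_mset P = n} = {}"
      by (auto dest!: multi_member_split)
    with True show ?thesis by (metis card.empty)
  next
    case False
    then have "{P \<in> D. j \<in># P \<and> sum_mset P = n} = add_mset j ` {P \<in> colon D j. sum_mset P = n - j}"
      by (auto simp: colon_def image_iff dest!: multi_member_split)
    with False show ?thesis by (simp add: card_image inj_on_def)
  qed
  ultimately show "weight_series D $ n =
      (weight_series {P \<in> D. j \<notin># P} + fps_X ^ j * weight_series (colon D j)) $ n"
    by (simp add: weight_series_def fps_X_power_mult_nth)
qed

text \<open>One factor per element suffices: the slices avoiding \<open>j\<close> only need the
  factors of \<open>S\<close>, and only the last colon, a fixed point, calls for
  \<open>1 - X^j\<close>.\<close>

lemma weight_series_down_closed_rational: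
  assumes "finite S" "\<forall>j\<in>S. (j::nat) > 0" "D \<subseteq> {P. set_mset P \<subseteq> S}" "down_closed D"
  shows "\<exists>f. weight_series D * (\<Prod>j\<in>S. 1 - fps_X ^ j) = fps_of_poly f"
  using assms
proof (induction S arbitrary: D rule: finite_induct)
  case empty
  \<comment> \<open>Only the empty multiset is available, so the series is the constant 0 or
    1.\<close>
  have "weight_series D = fps_of_poly [:int (card D):]"
  proof (rule fps_ext)
    fix n
    have "{P \<in> D. sum_mset P = n} = (if n = 0 then D else {})"
      using empty by auto
    then show "weight_series D $ n = fps_of_poly [:int (card D):] $ n"
      by (auto simp: weight_series_def coeff_pCons split: nat.split)
  qed
  then show ?case by auto
next
  case (insert j S)
  let ?\<Pi> = "(\<Prod>i\<in>S. 1 - fps_X ^ i) :: int fps"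
  have slice: "\<exists>f. weight_series {P \<in> E. j \<notin># P} * ?\<Pi> = fps_of_poly f"
    if "E \<subseteq> {P. set_mset P \<subseteq> insert j S}" "down_closed E" for E
    using that insert.prems(1)
    by (intro insert.IH) (auto simp: down_closed_def dest: mset_subset_eqD)
  have main: "\<exists>f. weight_series E * (?\<Pi> * (1 - fps_X ^ j)) = fps_of_poly f"
    if "E \<subseteq> {P. set_mset P \<subseteq> insert j S}" "down_closed E"
      "colon (((\<lambda>E. colon E j) ^^ k) E) j = ((\<lambda>E. colon E j) ^^ k) E" for E k
    using that
  proof (induction k arbitrary: E)
    case 0
    have "weight_series E = weight_series {P \<in> E. j \<notin># P} + fps_X ^ j * weight_series (colon E j)"
      using insert 0 by (intro weight_series_split[of "insert j S"]) auto
    \<comment> \<open>Here \<open>colon E j = E\<close>, so the unknown series stands on both sides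
      of the split.\<close>
    with 0 have "weight_series E * (1 - fps_X ^ j) = weight_series {P \<in> E. j \<notin># P}"
      by (simp add: algebra_simps)
    then have "weight_series E * (?\<Pi> * (1 - fps_X ^ j)) = weight_series {P \<in> E. j \<notin># P} * ?\<Pi>"
      by (simp only: mult.commute[of ?\<Pi> "1 - fps_X ^ j"] flip: mult.assoc)
    with slice[OF 0(1,2)] show ?case by (simp only:)
  next
    case (Suc k)
    have "weight_series E = weight_series {P \<in> E. j \<notin># P} + fps_X ^ j * weight_series (colon E j)"
      using insert Suc.prems by (intro weight_series_split[of "insert j S"]) auto
    then have eq: "weight_series E * (?\<Pi> * (1 - fps_X ^ j)) =
        weight_series {P \<in> E. j \<notin># P} * ?\<Pi> * (1 - fps_X ^ j)
        + fps_X ^ j * (weight_series (colon E j) * (?\<Pi> * (1 - fps_X ^ j)))"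
      by (simp add: algebra_simps)
    obtain g where g: "weight_series {P \<in> E. j \<notin># P} * ?\<Pi> = fps_of_poly g"
      using slice[OF Suc.prems(1,2)] by blast
    have "\<exists>h. weight_series (colon E j) * (?\<Pi> * (1 - fps_X ^ j)) = fps_of_poly h"
    proof (rule Suc.IH)
      show "colon E j \<subseteq> {P. set_mset P \<subseteq> insert j S}"
        using Suc.prems(1) colon_subset[OF Suc.prems(2), of j] by blast
      show "down_closed (colon E j)" by (rule down_closed_colon[OF Suc.prems(2)])
      \<comment> \<open>The colon chain of \<open>colon E j\<close> is that of \<open>E\<close>
        shifted by one, so it stabilises one step earlier.\<close>
      show "colon (((\<lambda>E. colon E j) ^^ k) (colon E j)) j = ((\<lambda>E. colon E j) ^^ k) (colon E j)"
        using Suc.prems(3) by (simp only: funpow_Suc_right o_apply)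
    qed
    then obtain h where h: "weight_series (colon E j) * (?\<Pi> * (1 - fps_X ^ j)) = fps_of_poly h"
      by blast
    have "weight_series E * (?\<Pi> * (1 - fps_X ^ j)) =
        fps_of_poly (g * (1 - monom 1 j) + monom 1 j * h)"
      unfolding eq g h
      by (simp add: fps_of_poly_add fps_of_poly_diff fps_of_poly_mult fps_of_poly_monom')
    then show ?case by blast
  qed
  obtain k where "colon (((\<lambda>E. colon E j) ^^ k) D) j = ((\<lambda>E. colon E j) ^^ k) D"
    using colon_chain_stabilises[OF _ insert.prems(2,3)] insert.hyps by auto
  from main[OF insert.prems(2,3) this] insert.hyps show ?case
    by (simp add: mult.commute)
qed

section \<open>The multinomial congruence\<close>

text \<open>The multiset order is total, well-founded and compatible with addition, so it plays the role
  of a monomial order.\<close>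

definition minimal_reps :: "nat set \<Rightarrow> nat multiset set" where
  "minimal_reps S = {P. set_mset P \<subseteq> S \<and>
     (\<forall>Q. set_mset Q \<subseteq> S \<and> sum_mset Q = sum_mset P \<and>
          multinomial_coeff Q = multinomial_coeff P \<longrightarrow> P \<le> Q)}"

lemma prod_mset_fact_pos: "(\<Prod>k\<in>#P. fact k :: real) > 0"
  by (induction P) auto

lemma multinomial_coeff_eq_iff:
  assumes "sum_mset P = sum_mset Q"
  shows "multinomial_coeff P = multinomial_coeff Q \<longleftrightarrow>
    (\<Prod>k\<in>#P. fact k :: real) = (\<Prod>k\<in>#Q. fact k)"
  using assms prod_mset_fact_pos[of P] prod_mset_fact_pos[of Q]
  by (auto simp: multinomial_coeff_def field_simps)

text \<open>Equal weights reduce both equalities to products of factorials, which are multiplicative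
  in the multiset.\<close>

lemma multinomial_coeff_add_cong:
  assumes "sum_mset P = sum_mset Q" "multinomial_coeff P = multinomial_coeff Q"
  shows "multinomial_coeff (P + R) = multinomial_coeff (Q + R)"
proof -
  have "(\<Prod>k\<in>#P. fact k :: real) = (\<Prod>k\<in>#Q. fact k)"
    using assms multinomial_coeff_eq_iff by blast
  then show ?thesis using assms(1) by (subst multinomial_coeff_eq_iff) auto
qed

text \<open>A smaller equivalent \<open>Q'\<close> of \<open>Q\<close> would give the smaller
  equivalent \<open>Q' + R\<close> of \<open>P\<close>, since the order is compatible with
  addition.\<close>

lemma down_closed_minimal_reps: "down_closed (minimal_reps S)"
  unfolding down_closed_def
proof (intro ballI allI impI)
  fix P Q assume P: "P \<in> minimal_reps S" and "Q \<subseteq># P"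
  then obtain R where R: "P = Q + R" by (metis mset_subset_eq_exists_conv)
  have "Q \<le> Q'" if Q': "set_mset Q' \<subseteq> S" "sum_mset Q' = sum_mset Q"
    "multinomial_coeff Q' = multinomial_coeff Q" for Q'
  proof -
    have "multinomial_coeff (Q' + R) = multinomial_coeff P"
      unfolding R using multinomial_coeff_add_cong Q' by blast
    then have "P \<le> Q' + R" using P Q' unfolding minimal_reps_def R
      by (simp del: add_le_cancel_right)
    then show ?thesis by (simp add: R)
  qed
  then show "Q \<in> minimal_reps S" using P R by (auto simp: minimal_reps_def)
qed

text \<open>Each value has exactly one representative: existence comes from well-foundedness,
  uniqueness from antisymmetry.\<close>

lemma M_eq_card_minimal_reps:
  assumes "\<forall>j\<in>S. j > 0"
  shows "M S n = card {P \<in> minimal_reps S. sum_mset P = n}"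
proof -
  let ?D = "{P \<in> minimal_reps S. sum_mset P = n}"
  have "inj_on multinomial_coeff ?D"
    by (rule inj_onI) (auto simp: minimal_reps_def intro!: antisym)
  moreover have "multinomial_coeff ` ?D = multinomial_coeff ` partitions_in S n"
  proof
    \<comment> \<open>Positivity of the elements of \<open>S\<close> supplies the condition
      \<open>0 \<notin># P\<close> of \<open>partitions_in\<close>.\<close>
    show "multinomial_coeff ` ?D \<subseteq> multinomial_coeff ` partitions_in S n"
      using assms by (intro image_mono) (auto simp: minimal_reps_def partitions_in_def)
    show "multinomial_coeff ` partitions_in S n \<subseteq> multinomial_coeff ` ?D"
    proof
      fix x assume "x \<in> multinomial_coeff ` partitions_in S n"
      then obtain P where P: "x = multinomial_coeff P" "set_mset P \<subseteq> S" "sum_mset P = n"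
        by (auto simp: partitions_in_def)
      define Pr where "Pr Q \<longleftrightarrow> set_mset Q \<subseteq> S \<and> sum_mset Q = n \<and> multinomial_coeff Q = x" for Q
      have "Pr P" using P by (simp add: Pr_def)
      then have "Pr (LEAST Q. Pr Q)" by (rule LeastI)
      moreover have "Pr Q \<Longrightarrow> (LEAST Q. Pr Q) \<le> Q" for Q by (rule Least_le)
      ultimately have "(LEAST Q. Pr Q) \<in> ?D \<and> multinomial_coeff (LEAST Q. Pr Q) = x"
        unfolding minimal_reps_def by (auto simp: Pr_def)
      then show "x \<in> multinomial_coeff ` ?D" by blast
    qed
  qed
  ultimately show ?thesis unfolding M_def by (metis card_image)
qed

section \<open>Passage from integer to real power series\<close>

text \<open>Counting over the integers yields an integral numerator; this coefficientwise embedding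
  transfers the identity to real series.\<close>

definition real_fps :: "int fps \<Rightarrow> real fps" where
  "real_fps F = Abs_fps (\<lambda>n. real_of_int (F $ n))"

lemma real_fps_mult: "real_fps (F * G) = real_fps F * real_fps G"
  by (rule fps_ext) (simp add: real_fps_def fps_mult_nth)

lemma real_fps_prod: "real_fps (\<Prod>j\<in>S. 1 - fps_X ^ j) = (\<Prod>j\<in>S. 1 - fps_X ^ j)"
proof (induction S rule: infinite_finite_induct)
  case (insert j S)
  have "real_fps (1 - fps_X ^ j) = 1 - fps_X ^ j"
    by (rule fps_ext) (simp add: real_fps_def fps_X_power_nth)
  with insert show ?case by (simp add: real_fps_mult)
qed (simp_all add: real_fps_def fps_eq_iff)

lemma M_series_rational:
  assumes "finite S" "\<forall>j\<in>S. j > 0"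
  shows "\<exists>f :: int poly. Abs_fps (\<lambda>n. real (M S n)) =
           fps_of_poly (map_poly real_of_int f) / (\<Prod>j\<in>S. 1 - fps_X ^ j)"
proof -
  let ?\<Pi> = "(\<Prod>j\<in>S. 1 - fps_X ^ j) :: real fps"
  have "minimal_reps S \<subseteq> {P. set_mset P \<subseteq> S}" by (auto simp: minimal_reps_def)
  then obtain f where f: "weight_series (minimal_reps S) * (\<Prod>j\<in>S. 1 - fps_X ^ j) = fps_of_poly f"
    using weight_series_down_closed_rational[OF assms] down_closed_minimal_reps by blast
  have "Abs_fps (\<lambda>n. real (M S n)) = real_fps (weight_series (minimal_reps S))"
    by (rule fps_ext) (simp add: real_fps_def weight_series_def M_eq_card_minimal_reps[OF assms(2)])
  moreover have "real_fps (fps_of_poly f) = fps_of_poly (map_poly real_of_int f)"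
    by (rule fps_ext) (simp add: real_fps_def coeff_map_poly)
  ultimately have "Abs_fps (\<lambda>n. real (M S n)) * ?\<Pi> = fps_of_poly (map_poly real_of_int f)"
    by (metis f real_fps_mult real_fps_prod)
  \<comment> \<open>Every factor has constant coefficient 1 because its exponent is positive; hence
    the product can be cancelled.\<close>
  moreover have "?\<Pi> \<noteq> 0"
  proof -
    have "(1 - fps_X ^ j :: real fps) $ 0 \<noteq> 0" if "j \<in> S" for j
      using assms(2) that by (simp add: fps_X_power_nth)
    then show ?thesis using assms(1) by (metis fps_zero_nth prod_zero_iff)
  qed
  ultimately show ?thesis by (metis nonzero_mult_div_cancel_right)
qed

section \<open>Partial fractions and quasipolynomials\<close>

text \<open>Split \<open>d = gcd d b * e\<close>. The square of \<open>gcd e b\<close> divides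
  \<open>d\<close>, so \<open>e\<close> is coprime to \<open>b\<close>; as \<open>e\<close> divides
  \<open>b ^ n\<close>, it is a unit.\<close>

lemma squarefree_dvd_powerD:
  fixes d b :: "'a :: semiring_gcd"
  assumes "squarefree d" "d dvd b ^ n"
  shows "d dvd b"
proof -
  obtain e where e: "d = gcd d b * e" by (meson dvdE gcd_dvd1)
  have "gcd e b dvd gcd d b"
    by (metis dvd_triv_right e gcd_dvd1 gcd_dvd2 gcd_greatest dvd_trans)
  then have "gcd e b ^ 2 dvd d"
    by (subst e) (auto simp: power2_eq_square intro: mult_dvd_mono)
  then have "coprime e b"
    using assms(1) by (auto dest: squarefreeD simp: is_unit_gcd)
  then have "coprime e (b ^ n)" by simp
  moreover have "e dvd b ^ n" using e assms(2) by (metis dvd_mult_right)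
  ultimately have "is_unit e" using coprime_common_divisor dvd_refl by blast
  then have "d dvd gcd d b" by (metis e dvd_refl mult_unit_dvd_iff)
  then show ?thesis by simp
qed

text \<open>A square factor \<open>x ^ 2\<close> forces \<open>x\<close> to divide the derivative
  too, and \<open>1 - X^j\<close> is coprime to its derivative.\<close>

lemma squarefree_one_minus_monom:
  assumes "j > 0"
  shows "squarefree (1 - monom 1 j :: real poly)"
proof (rule squarefreeI)
  fix x :: "real poly" assume "x ^ 2 dvd 1 - monom 1 j"
  then obtain y where y: "1 - monom 1 j = x * (x * y)"
    by (metis dvdE mult.assoc power2_eq_square)
  have "pderiv (1 - monom 1 j) = x * (pderiv x * y + pderiv (x * y))"
    unfolding y pderiv_mult[of x "x * y"] by (simp add: algebra_simps)
  then have "x dvd pderiv (1 - monom 1 j)" by simp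
  then have "x dvd monom (real j) (j - 1)"
    by (simp add: pderiv_diff pderiv_monom)
  \<comment> \<open>Multiplying by X restores the degree \<open>j\<close>; adding \<open>j\<close>
    times the polynomial then leaves the nonzero constant \<open>j\<close>.\<close>
  then have "x dvd monom (real j) (j - 1) * monom 1 1" by (rule dvd_mult2)
  moreover have "monom (real j) (j - 1) * monom 1 1 = smult (real j) (monom 1 j)"
    using assms by (simp add: mult_monom smult_monom)
  moreover have "x dvd smult (real j) (1 - monom 1 j)" using y by (simp add: dvd_smult)
  ultimately have "x dvd smult (real j) (1 - monom 1 j) + smult (real j) (monom 1 j)"
    by (metis dvd_add)
  then have "x dvd smult (real j) 1" by (simp add: smult_diff_right)
  then show "x dvd 1" using assms by (simp only: dvd_smult_iff of_nat_eq_0_iff)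
qed

text \<open>Since \<open>1 - X\<^sup>j\<close> is squarefree, its gcd with any power of \<open>1 - X\<^sup>s\<close> already divides
  \<open>1 - X\<^sup>s\<close>. This keeps the denominators of the partial fractions powers of a single
  \<open>1 - X\<^sup>s\<close>, and hence the periods divisors of elements of \<open>S\<close>.\<close>

lemma bezout_one_minus_monom:
  assumes "j > 0"
  shows "\<exists>A B :: real poly. 1 - monom 1 s = A * (1 - monom 1 j) + B * (1 - monom 1 s) ^ K"
proof -
  let ?a = "1 - monom 1 j :: real poly" and ?b = "1 - monom 1 s :: real poly"
  have "squarefree (gcd ?a (?b ^ K))"
    using squarefree_one_minus_monom[OF assms] squarefree_mono gcd_dvd1 by blast
  then have "gcd ?a (?b ^ K) dvd ?b"
    by (rule squarefree_dvd_powerD) (rule gcd_dvd2)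
  then obtain c where c: "?b = gcd ?a (?b ^ K) * c" by (rule dvdE)
  obtain u v where "u * ?a + v * ?b ^ K = gcd ?a (?b ^ K)"
    by (metis bezout_coefficients_fst_snd)
  \<comment> \<open>Scaling the Bezout identity by the cofactor \<open>c\<close> turns the gcd into
    \<open>?b\<close>.\<close>
  then have "?b = (c * u) * ?a + (c * v) * ?b ^ K"
    by (subst c) (metis (no_types, lifting) distrib_left mult.assoc mult.commute)
  then show ?thesis by blast
qed

section \<open>Partial fraction decomposition\<close>

abbreviation geom_fps :: "nat \<Rightarrow> real fps" where
  "geom_fps s \<equiv> inverse (1 - fps_X ^ s)"

lemma one_minus_mult_geom_fps: "s > 0 \<Longrightarrow> (1 - fps_X ^ s) * geom_fps s = 1"
  by (rule inverse_mult_eq_1') (simp add: fps_X_power_nth)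

lemma fps_of_poly_one_minus_monom:
  "fps_of_poly (1 - monom 1 s :: real poly) = 1 - fps_X ^ s"
  by (simp add: fps_of_poly_diff fps_of_poly_monom')

text \<open>Each old term times \<open>geom_fps j\<close> splits into a term over \<open>s\<close>
  and one over \<open>j\<close>. One exponent \<open>K\<close> is shared by all terms and grows by
  one per induction step.\<close>

lemma partial_fractions:
  assumes "finite S" "\<forall>j\<in>S. j > 0"
  shows "\<exists>p N K. fps_of_poly f * (\<Prod>j\<in>S. geom_fps j) =
    fps_of_poly p + (\<Sum>s\<in>S. fps_of_poly (N s) * geom_fps s ^ K)"
  using assms
proof (induction S rule: finite_induct)
  case empty
  show ?case by auto
next
  case (insert j S)
  then obtain p N K where IH: "fps_of_poly f * (\<Prod>j\<in>S. geom_fps j) =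
    fps_of_poly p + (\<Sum>s\<in>S. fps_of_poly (N s) * geom_fps s ^ K)" by auto
  have "j > 0" using insert.prems by auto
  \<comment> \<open>Bezout reaches only \<open>1 - X^s\<close>, not 1, since the polynomials share
    the root 1. Each fraction is therefore first expanded by \<open>1 - X^s\<close>, which explains
    \<open>Suc K\<close>.\<close>
  obtain A B where AB: "\<And>s. 1 - monom 1 s = A s * (1 - monom 1 j) + B s * (1 - monom 1 s :: real poly) ^ Suc K"
    using bezout_one_minus_monom[OF \<open>j > 0\<close>, of _ "Suc K"] by metis
  have summand: "fps_of_poly (N s) * geom_fps s ^ K * geom_fps j =
      fps_of_poly (N s * A s) * geom_fps s ^ Suc K + fps_of_poly (N s * B s) * geom_fps j"
    if "s \<in> S" for s
  proof -
    let ?g = "geom_fps s" and ?h = "geom_fps j" and ?x = "1 - fps_X ^ s :: real fps"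
      and ?y = "1 - fps_X ^ j :: real fps"
    have gx: "?x * ?g = 1" using one_minus_mult_geom_fps insert.prems that by auto
    have hy: "?y * ?h = 1" using one_minus_mult_geom_fps \<open>j > 0\<close> by auto
    have x: "?x = fps_of_poly (A s) * ?y + fps_of_poly (B s) * ?x ^ Suc K"
      using arg_cong[OF AB[of s], of fps_of_poly]
      by (simp only: fps_of_poly_add fps_of_poly_mult fps_of_poly_power fps_of_poly_one_minus_monom)
    have xg: "?x ^ Suc K * ?g ^ Suc K = 1"
      by (metis gx power_mult_distrib power_one)
    have "?g ^ K * ?h = ?x * (?g ^ Suc K * ?h)"
      using gx by (metis (no_types, lifting) mult.assoc mult_1 power_Suc)
    also have "\<dots> = fps_of_poly (A s) * ?g ^ Suc K * (?y * ?h)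
        + fps_of_poly (B s) * ?h * (?x ^ Suc K * ?g ^ Suc K)"
      by (subst x) (simp only: algebra_simps)
    finally have "?g ^ K * ?h = fps_of_poly (A s) * ?g ^ Suc K + fps_of_poly (B s) * ?h"
      by (simp only: hy xg mult_1_right)
    then show ?thesis
      by (simp only: mult.assoc fps_of_poly_mult distrib_left)
  qed
  \<comment> \<open>\<open>q\<close> collects everything that ends up over \<open>1 - X^j\<close>:
    the polynomial part and the second Bezout terms.\<close>
  define q where "q = p + (\<Sum>s\<in>S. N s * B s)"
  have "fps_of_poly f * (\<Prod>j\<in>insert j S. geom_fps j)
      = (fps_of_poly f * (\<Prod>j\<in>S. geom_fps j)) * geom_fps j"
    using insert.hyps by (simp add: mult_ac)
  also have "\<dots> = fps_of_poly p * geom_fps j + (\<Sum>s\<in>S. fps_of_poly (N s) * geom_fps s ^ K * geom_fps j)"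
    unfolding IH by (simp add: distrib_right sum_distrib_right)
  also have "\<dots> = (\<Sum>s\<in>S. fps_of_poly (N s * A s) * geom_fps s ^ Suc K) + fps_of_poly q * geom_fps j"
    unfolding q_def
    by (simp add: summand sum.distrib fps_of_poly_add fps_of_poly_sum distrib_right sum_distrib_right
          del: power_Suc)
  \<comment> \<open>Expanding by the \<open>K\<close>-th power brings the term over \<open>j\<close>
    to the common exponent \<open>Suc K\<close>.\<close>
  also have "fps_of_poly q * geom_fps j =
      fps_of_poly (q * (1 - monom 1 j) ^ K) * geom_fps j ^ Suc K"
  proof -
    have "(1 - fps_X ^ j) ^ K * geom_fps j ^ K = 1"
      using one_minus_mult_geom_fps[OF \<open>j > 0\<close>] by (metis power_mult_distrib power_one)
    then show ?thesis
      by (simp add: fps_of_poly_mult fps_of_poly_power fps_of_poly_one_minus_monom mult_ac)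
  qed
  finally have "fps_of_poly f * (\<Prod>j\<in>insert j S. geom_fps j) = fps_of_poly 0 +
      (\<Sum>s\<in>insert j S. fps_of_poly ((\<lambda>s. if s = j then q * (1 - monom 1 j) ^ K else N s * A s) s)
        * geom_fps s ^ Suc K)"
    using insert.hyps by (subst sum.insert) (auto intro!: sum.cong simp del: power_Suc)
  then show ?case by (intro exI)
qed

section \<open>Sequences that are eventually quasipolynomial\<close>

text \<open>With one polynomial per residue class instead of periodic coefficients, the closure
  properties reduce to polynomial arithmetic.\<close>

definition eventually_quasipoly :: "nat \<Rightarrow> (nat \<Rightarrow> real) \<Rightarrow> bool" where
  "eventually_quasipoly s a \<longleftrightarrow>
     (\<exists>P :: nat \<Rightarrow> real poly. \<forall>\<^sub>F n in sequentially. a n = poly (P (n mod s)) (real n))"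

lemma eventually_quasipoly_add:
  assumes "eventually_quasipoly s a" "eventually_quasipoly s b"
  shows "eventually_quasipoly s (\<lambda>n. a n + b n)"
proof -
  obtain P Q where "\<forall>\<^sub>F n in sequentially. a n = poly (P (n mod s)) (real n)"
    "\<forall>\<^sub>F n in sequentially. b n = poly (Q (n mod s)) (real n)"
    using assms unfolding eventually_quasipoly_def by blast
  then have "\<forall>\<^sub>F n in sequentially. a n + b n = poly (P (n mod s) + Q (n mod s)) (real n)"
    by eventually_elim simp
  then show ?thesis
    unfolding eventually_quasipoly_def by (intro exI[of _ "\<lambda>r. P r + Q r"])
qed

lemma eventually_quasipoly_scale:
  assumes "eventually_quasipoly s a"
  shows "eventually_quasipoly s (\<lambda>n. c * a n)"
proof -
  obtain P where "\<forall>\<^sub>F n in sequentially. a n = poly (P (n mod s)) (real n)"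
    using assms unfolding eventually_quasipoly_def by blast
  then have "\<forall>\<^sub>F n in sequentially. c * a n = poly (smult c (P (n mod s))) (real n)"
    by eventually_elim simp
  then show ?thesis
    unfolding eventually_quasipoly_def by (intro exI[of _ "\<lambda>r. smult c (P r)"])
qed

lemma eventually_quasipoly_shift:
  assumes "eventually_quasipoly s a" "s > 0"
  shows "eventually_quasipoly s (\<lambda>n. if n = 0 then 0 else a (n - 1))"
proof -
  obtain P where P: "\<forall>\<^sub>F n in sequentially. a n = poly (P (n mod s)) (real n)"
    using assms unfolding eventually_quasipoly_def by blast
  \<comment> \<open>Adding \<open>s - 1\<close> steps back one residue without leaving the naturals;
    composing with X - 1 evaluates at \<open>n - 1\<close>.\<close>
  define Q where "Q r = pcompose (P ((r + (s - 1)) mod s)) [:-1, 1:]" for r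
  have "\<forall>\<^sub>F n in sequentially.
      (if Suc n = 0 then 0 else a (Suc n - 1)) = poly (Q (Suc n mod s)) (real (Suc n))"
    using P
  proof eventually_elim
    case (elim n)
    have "(Suc n mod s + (s - 1)) mod s = (Suc n + (s - 1)) mod s"
      by (simp add: mod_add_left_eq)
    also have "Suc n + (s - 1) = n + s" using assms(2) by simp
    finally have "(Suc n mod s + (s - 1)) mod s = n mod s" by simp
    with elim show ?case by (simp add: Q_def poly_pcompose)
  qed
  then have "\<forall>\<^sub>F n in sequentially. (if n = 0 then 0 else a (n - 1)) = poly (Q (n mod s)) (real n)"
    by (subst (asm) eventually_sequentially_Suc)
  then show ?thesis unfolding eventually_quasipoly_def by blast
qed

text \<open>Horner scheme: multiplication by X is the index shift.\<close>

lemma eventually_quasipoly_mult_poly: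
  assumes "eventually_quasipoly s (fps_nth F)" "s > 0"
  shows "eventually_quasipoly s (fps_nth (fps_of_poly N * F))"
proof (induction N)
  case 0
  show ?case
    unfolding eventually_quasipoly_def by (intro exI[of _ "\<lambda>_. 0"]) simp
next
  case (pCons c N)
  have "fps_of_poly (pCons c N) * F = fps_const c * F + fps_X * (fps_of_poly N * F)"
    by (simp only: fps_of_poly_pCons distrib_right distrib_left mult_ac)
  then have "fps_nth (fps_of_poly (pCons c N) * F) =
      (\<lambda>n. c * F $ n + (if n = 0 then 0 else (fps_of_poly N * F) $ (n - 1)))"
    by (auto simp: fun_eq_iff)
  then show ?case
    using eventually_quasipoly_add[OF eventually_quasipoly_scale[OF assms(1)]
        eventually_quasipoly_shift[OF pCons(2) assms(2)]] by simp
qed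

text \<open>This is the negative binomial series in \<open>X^s\<close>.\<close>

lemma geom_fps_power_nth:
  assumes "s > 0"
  shows "(geom_fps s ^ Suc k) $ n = (if s dvd n then real ((n div s + k) choose k) else 0)"
proof -
  define F where "F k = Abs_fps (\<lambda>n. if s dvd n then real ((n div s + k) choose k) else 0)" for k
  have F0: "(1 - fps_X ^ s) * F 0 = 1"
  proof (rule fps_ext)
    fix n
    show "((1 - fps_X ^ s) * F 0) $ n = (1 :: real fps) $ n"
      using assms by (auto simp: F_def left_diff_distrib fps_X_power_mult_nth dvd_diff_nat dvd_imp_le
          intro: dvd_diffD)
  qed
  \<comment> \<open>On positive multiples of \<open>s\<close> this is Pascal's rule; off the
    multiples both sides vanish.\<close>
  have FSuc: "(1 - fps_X ^ s) * F (Suc k) = F k" for k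
  proof (rule fps_ext)
    fix n
    show "((1 - fps_X ^ s) * F (Suc k)) $ n = F k $ n"
    proof (cases "s dvd n")
      case True
      then obtain m where m: "n = s * m" by blast
      show ?thesis
      proof (cases m)
        case 0
        then show ?thesis using assms by (simp add: F_def m left_diff_distrib fps_X_power_mult_nth)
      next
        case (Suc m')
        have "n - s = s * m'" using Suc m by simp
        then show ?thesis using assms m Suc
          by (simp add: F_def left_diff_distrib fps_X_power_mult_nth)
      qed
    next
      case False
      then show ?thesis
        by (auto simp: F_def left_diff_distrib fps_X_power_mult_nth dest: dvd_diffD)
    qed
  qed
  have "geom_fps s ^ Suc k = F k"
  proof (induction k)
    case 0
    have "geom_fps s = geom_fps s * ((1 - fps_X ^ s) * F 0)" by (simp add: F0)
    also have "\<dots> = ((1 - fps_X ^ s) * geom_fps s) * F 0" by (simp only: mult_ac)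
    finally show ?case using one_minus_mult_geom_fps[OF assms] by simp
  next
    case (Suc k)
    have "geom_fps s ^ Suc (Suc k) = geom_fps s * F k" using Suc by simp
    also have "\<dots> = ((1 - fps_X ^ s) * geom_fps s) * F (Suc k)"
      unfolding FSuc[of k, symmetric] by (simp only: mult_ac)
    finally show ?case using one_minus_mult_geom_fps[OF assms] by simp
  qed
  then show ?thesis by (simp add: F_def)
qed

lemma eventually_quasipoly_geom_fps_power:
  assumes "s > 0"
  shows "eventually_quasipoly s (fps_nth (geom_fps s ^ K))"
proof (cases K)
  case 0
  \<comment> \<open>The coefficients of the series 1 vanish beyond index 0, so the zero polynomial
    serves.\<close>
  have "\<forall>\<^sub>F n in sequentially. (1 :: real fps) $ n = poly 0 (real n)"
    using eventually_gt_at_top[of 0] by eventually_elim simp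
  then show ?thesis
    unfolding eventually_quasipoly_def 0 by (intro exI[of _ "\<lambda>_. 0"]) simp
next
  case (Suc k)
  \<comment> \<open>At \<open>n\<close> this is (n/s + 1)...(n/s + k) / k!, the binomial coefficient
    as a rising factorial.\<close>
  define B :: "real poly" where "B = smult (1 / fact k) (\<Prod>i<k. [:1 + real i, 1 / real s:])"
  have "real ((n div s + k) choose k) = poly B (real n)" if "s dvd n" for n
  proof -
    from that assms have q: "real (n div s) = real n / real s" by (simp add: real_of_nat_div)
    have "real ((n div s + k) choose k) = pochhammer (real (n div s) + 1) k / fact k"
      by (simp add: binomial_gbinomial gbinomial_pochhammer' add_ac)
    then show ?thesis
      by (simp add: B_def poly_prod pochhammer_prod q add_ac atLeast0LessThan)
  qed
  then have "(geom_fps s ^ K) $ n = poly ((\<lambda>r. if r = 0 then B else 0) (n mod s)) (real n)" for n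
    unfolding Suc geom_fps_power_nth[OF assms] by (auto simp: dvd_eq_mod_eq_0)
  then show ?thesis unfolding eventually_quasipoly_def by (intro exI always_eventually allI)
qed

section \<open>Periodic coefficient functions\<close>

text \<open>The definition numbers its summands, hence the enumeration \<open>e\<close> of
  \<open>S\<close>; each period \<open>s\<close> divides itself.\<close>

lemma sum_of_periodic_dividing_sum:
  assumes "finite S" "\<And>s. s \<in> S \<Longrightarrow> has_period s (g s)"
  shows "sum_of_periodic_dividing S (\<lambda>n. \<Sum>s\<in>S. g s n)"
proof -
  obtain e where e: "bij_betw e {..<card S} S"
    using ex_bij_betw_nat_finite[OF assms(1)] by (auto simp: atLeast0LessThan)
  have "(\<Sum>s\<in>S. g s n) = (\<Sum>l<card S. g (e l) n)" for n
    by (rule sum.reindex_bij_betw[OF e, symmetric])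
  moreover have "\<exists>d. (\<exists>s\<in>S. d dvd s) \<and> has_period d (g (e l))" if "l < card S" for l
  proof -
    have "e l \<in> S" using e that by (auto dest: bij_betwE)
    with assms(2) show ?thesis by (intro exI[of _ "e l"]) (auto intro: bexI[of _ "e l"])
  qed
  ultimately show ?thesis
    unfolding sum_of_periodic_dividing_def
    by (intro exI[of _ "card S"] exI[of _ "\<lambda>l. g (e l)"]) simp
qed

lemma has_period_mult:
  assumes "has_period p f" "q > 0"
  shows "has_period (p * q) f"
proof -
  have "f (n + p * k) = f n" for n k
  proof (induction k)
    case (Suc k)
    have "f (n + p * k + p) = f (n + p * k)" using assms(1) by (simp add: has_period_def)
    with Suc show ?case by (simp add: algebra_simps)
  qed simp
  with assms show ?thesis by (simp add: has_period_def)
qed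

text \<open>The product of the elements of \<open>S\<close> is a common period.\<close>

lemma periodic_sum:
  assumes "finite S" "\<And>s. s \<in> S \<Longrightarrow> has_period s (g s)"
  shows "periodic (\<lambda>n. \<Sum>s\<in>S. g s n)"
proof -
  have pos: "s > 0" if "s \<in> S" for s using assms(2)[OF that] by (simp add: has_period_def)
  have "has_period (\<Prod>S) (g s)" if "s \<in> S" for s
  proof -
    have "\<Prod>S = s * \<Prod>(S - {s})" using assms(1) that by (simp add: prod.remove)
    moreover have "\<Prod>(S - {s}) > 0" using pos by (auto intro: prod_pos)
    ultimately show ?thesis using has_period_mult assms(2)[OF that] by metis
  qed
  moreover have "\<Prod>S > 0" using pos by (auto intro: prod_pos)
  ultimately have "has_period (\<Prod>S) (\<lambda>n. \<Sum>s\<in>S. g s n)" by (simp add: has_period_def)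
  then show ?thesis unfolding periodic_def by blast
qed

lemma poly_eq_sum_coeff:
  fixes p :: "real poly"
  assumes "degree p \<le> m"
  shows "poly p x = (\<Sum>i=0..m. coeff p i * x ^ i)"
  unfolding poly_altdef using assms
  by (intro sum.mono_neutral_left) (auto simp: coeff_eq_0)

section \<open>Quasipolynomials from rational generating functions\<close>

text \<open>Past its degree the polynomial part vanishes, and each partial fraction is eventually a
  quasipolynomial modulo a single \<open>s\<close>; grouping by powers of \<open>n\<close> gives
  coefficients that are sums over \<open>S\<close>.\<close>

lemma quasipoly_of_rational:
  assumes S: "finite S" "\<forall>j\<in>S. j > 0"
  shows "\<exists>(n0::nat) (m::nat) (c :: nat \<Rightarrow> nat \<Rightarrow> real).
      (\<forall>i\<le>m. periodic (c i) \<and> sum_of_periodic_dividing S (c i)) \<and>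
      (\<forall>n\<ge>n0. (fps_of_poly f / (\<Prod>j\<in>S. 1 - fps_X ^ j)) $ n = (\<Sum>i=0..m. c i n * real n ^ i))"
proof -
  let ?F = "fps_of_poly f / (\<Prod>j\<in>S. 1 - fps_X ^ j) :: real fps"
  have "(\<Prod>j\<in>S. 1 - fps_X ^ j) * (\<Prod>j\<in>S. geom_fps j) = (\<Prod>j\<in>S. (1 - fps_X ^ j) * geom_fps j)"
    by (simp add: prod.distrib)
  also have "\<dots> = 1" using S(2) by (intro prod.neutral) (auto simp: one_minus_mult_geom_fps)
  finally have inv: "(\<Prod>j\<in>S. 1 - fps_X ^ j) * (\<Prod>j\<in>S. geom_fps j) = 1" .
  then have "(\<Prod>j\<in>S. 1 - fps_X ^ j :: real fps) \<noteq> 0" by auto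
  moreover have "fps_of_poly f = fps_of_poly f * (\<Prod>j\<in>S. geom_fps j) * (\<Prod>j\<in>S. 1 - fps_X ^ j)"
    using inv by (metis mult.assoc mult.commute mult_1_right)
  ultimately have F: "?F = fps_of_poly f * (\<Prod>j\<in>S. geom_fps j)"
    by (metis nonzero_mult_div_cancel_right)
  obtain p N K where pf: "?F = fps_of_poly p + (\<Sum>s\<in>S. fps_of_poly (N s) * geom_fps s ^ K)"
    unfolding F using partial_fractions[OF S] by blast
  have "\<exists>P. \<forall>\<^sub>F n in sequentially.
      (fps_of_poly (N s) * geom_fps s ^ K) $ n = poly (P (n mod s)) (real n)"
    if "s \<in> S" for s
  proof -
    have "s > 0" using S(2) that by blast
    then show ?thesis
      using eventually_quasipoly_mult_poly[OF eventually_quasipoly_geom_fps_power]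
      unfolding eventually_quasipoly_def by blast
  qed
  then obtain P where P: "\<forall>s\<in>S. \<forall>\<^sub>F n in sequentially.
      (fps_of_poly (N s) * geom_fps s ^ K) $ n = poly (P s (n mod s)) (real n)"
    by metis
  \<comment> \<open>A degree bound uniform in \<open>s\<close> and the residue; inserting 0 keeps
    \<open>Max\<close> meaningful for empty \<open>S\<close>.\<close>
  define m where "m = Max (insert 0 ((\<lambda>(s, r). degree (P s r)) ` (SIGMA s:S. {..<s})))"
  have m: "degree (P s r) \<le> m" if "s \<in> S" "r < s" for s r
    unfolding m_def using S(1) that by (intro Max_ge) force+
  define c where "c i n = (\<Sum>s\<in>S. coeff (P s (n mod s)) i)" for i n
  have per: "has_period s (\<lambda>n. coeff (P s (n mod s)) i)" if "s \<in> S" for s i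
    using that S(2) by (simp add: has_period_def)
  have "\<forall>\<^sub>F n in sequentially. \<forall>s\<in>S.
      (fps_of_poly (N s) * geom_fps s ^ K) $ n = poly (P s (n mod s)) (real n)"
    using P S(1) by (simp add: eventually_ball_finite)
  moreover have "\<forall>\<^sub>F n in sequentially. coeff p n = 0"
    using eventually_gt_at_top[of "degree p"] by eventually_elim (simp add: coeff_eq_0)
  ultimately have "\<forall>\<^sub>F n in sequentially. ?F $ n = (\<Sum>i=0..m. c i n * real n ^ i)"
  proof eventually_elim
    case (elim n)
    have "?F $ n = (\<Sum>s\<in>S. poly (P s (n mod s)) (real n))"
      unfolding pf using elim by (simp add: fps_sum_nth)
    also have "\<dots> = (\<Sum>s\<in>S. \<Sum>i=0..m. coeff (P s (n mod s)) i * real n ^ i)"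
      using S(2) by (intro sum.cong refl poly_eq_sum_coeff m) auto
    also have "\<dots> = (\<Sum>i=0..m. c i n * real n ^ i)"
      unfolding c_def sum_distrib_right by (rule sum.swap)
    finally show ?case .
  qed
  moreover have "periodic (c i)" "sum_of_periodic_dividing S (c i)" for i
    unfolding c_def[abs_def]
    using per by (auto intro!: periodic_sum sum_of_periodic_dividing_sum S(1))
  ultimately show ?thesis unfolding eventually_sequentially by blast
qed

theorem theorem5:
  fixes S :: "nat set"
  assumes "finite S" and "\<forall>j\<in>S. j > 0"
  shows "(\<exists>f :: int poly.
            Abs_fps (\<lambda>n. real (M S n)) =
              fps_of_poly (map_poly real_of_int f) / (\<Prod>j\<in>S. 1 - fps_X ^ j)) \<and>
         (\<exists>(n0::nat) (m::nat) (c :: nat \<Rightarrow> nat \<Rightarrow> real).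
            (\<forall>i\<le>m. periodic (c i) \<and> sum_of_periodic_dividing S (c i)) \<and>
            (\<forall>n\<ge>n0. real (M S n) = (\<Sum>i=0..m. c i n * real n ^ i)))"
proof -
  obtain f :: "int poly" where f: "Abs_fps (\<lambda>n. real (M S n)) =
      fps_of_poly (map_poly real_of_int f) / (\<Prod>j\<in>S. 1 - fps_X ^ j)"
    using M_series_rational[OF assms] by blast
  have "real (M S n) = (fps_of_poly (map_poly real_of_int f) / (\<Prod>j\<in>S. 1 - fps_X ^ j)) $ n" for n
    by (simp flip: f)
  with f quasipoly_of_rational[OF assms, of "map_poly real_of_int f"] show ?thesis by auto
qed

end
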